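(* There exists a normalized binary goods instance with 113 agents for which no randomized allocation is ex-post both EF1 and EQ1 (with no ex-ante requirement imposed); that is, there is no randomized allocation every support allocation of which is both EF1 and EQ1.
   Context: An instance consists of agents $N=\{1,\dots,n\}$, a finite set $M$ of indivisible items, and for each agent $i$ an additive valuation $v_i:2^M\to\mathbb{R}$, i.e. $v_i(\emptyset)=0$ and $v_i(S)=\sum_{o\in S}v_i(o)$. It is a binary goods instance if $v_i(o)\in\{0,1\}$ for all $i,o$. It is normalized if $v_i(M)=v_j(M)$ for all $i,j\in N$. An allocation $A=(A_1,\dots,A_n)$ is a partition of $M$ into $n$ pairwise disjoint, possibly empty bundles with union $M$. For goods: $A$ is EF1 if for all $i,j\in N$ with $A_j\neq\emptyset$ there is $g\in A_j$ with $v_i(A_i)\ge v_i(A_j\setminus\{g\})$. $A$ is EQ1 if for all $i,j\in N$ with $A_j\neq\emptyset$ there is $g\in A_j$ with $v_i(A_i)\ge v_j(A_j\setminus\{g\})$. A randomized allocation is a probability distribution over finitely many deterministic allocations. It satisfies a property ex-post if every allocation in its support satisfies that property. *)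

theory Defs
  imports "HOL-Probability.Probability_Mass_Function" "HOL-Library.FuncSet"
begin

definition agents :: "nat \<Rightarrow> nat set" where
  "agents n = {1..n}"

text \<open>A valuation is a function on bundles; only its values on subsets of \<open>M\<close> are constrained.
  The value of a single item \<open>x\<close> is \<open>v i {x}\<close>.\<close>

definition additive_valuation :: "'a set \<Rightarrow> ('a set \<Rightarrow> real) \<Rightarrow> bool" where
  "additive_valuation M u \<longleftrightarrow> u {} = 0 \<and> (\<forall>S. S \<subseteq> M \<longrightarrow> u S = (\<Sum>x\<in>S. u {x}))"

definition is_instance :: "nat \<Rightarrow> 'a set \<Rightarrow> (nat \<Rightarrow> 'a set \<Rightarrow> real) \<Rightarrow> bool" where
  "is_instance n M v \<longleftrightarrow> finite M \<and> (\<forall>i\<in>agents n. additive_valuation M (v i))"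

definition binary_goods :: "nat \<Rightarrow> 'a set \<Rightarrow> (nat \<Rightarrow> 'a set \<Rightarrow> real) \<Rightarrow> bool" where
  "binary_goods n M v \<longleftrightarrow> (\<forall>i\<in>agents n. \<forall>x\<in>M. v i {x} \<in> {0, 1})"

definition normalized :: "nat \<Rightarrow> 'a set \<Rightarrow> (nat \<Rightarrow> 'a set \<Rightarrow> real) \<Rightarrow> bool" where
  "normalized n M v \<longleftrightarrow> (\<forall>i\<in>agents n. \<forall>j\<in>agents n. v i M = v j M)"

text \<open>The extensional function space makes an allocation exactly an \<open>n\<close>-tuple of bundles:
  values outside the set of agents are fixed to \<open>undefined\<close>.\<close>

definition allocation :: "nat \<Rightarrow> 'a set \<Rightarrow> (nat \<Rightarrow> 'a set) \<Rightarrow> bool" where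
  "allocation n M A \<longleftrightarrow>
     A \<in> agents n \<rightarrow>\<^sub>E Pow M \<and>
     (\<forall>i\<in>agents n. \<forall>j\<in>agents n. i \<noteq> j \<longrightarrow> A i \<inter> A j = {}) \<and>
     (\<Union>i\<in>agents n. A i) = M"

definition EF1 :: "nat \<Rightarrow> (nat \<Rightarrow> 'a set \<Rightarrow> real) \<Rightarrow> (nat \<Rightarrow> 'a set) \<Rightarrow> bool" where
  "EF1 n v A \<longleftrightarrow>
     (\<forall>i\<in>agents n. \<forall>j\<in>agents n. A j \<noteq> {} \<longrightarrow> (\<exists>g\<in>A j. v i (A i) \<ge> v i (A j - {g})))"

definition EQ1 :: "nat \<Rightarrow> (nat \<Rightarrow> 'a set \<Rightarrow> real) \<Rightarrow> (nat \<Rightarrow> 'a set) \<Rightarrow> bool" where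
  "EQ1 n v A \<longleftrightarrow>
     (\<forall>i\<in>agents n. \<forall>j\<in>agents n. A j \<noteq> {} \<longrightarrow> (\<exists>g\<in>A j. v i (A i) \<ge> v j (A j - {g})))"

definition randomized_allocation :: "nat \<Rightarrow> 'a set \<Rightarrow> (nat \<Rightarrow> 'a set) pmf \<Rightarrow> bool" where
  "randomized_allocation n M p \<longleftrightarrow> finite (set_pmf p) \<and> (\<forall>A\<in>set_pmf p. allocation n M A)"

definition ex_post :: "((nat \<Rightarrow> 'a set) \<Rightarrow> bool) \<Rightarrow> (nat \<Rightarrow> 'a set) pmf \<Rightarrow> bool" where
  "ex_post P p \<longleftrightarrow> (\<forall>A\<in>set_pmf p. P A)"

end

theory Submission imports Defs begin

text \<open>The items are the points of the projective space \<open>PG(4,2)\<close>, each taken 11 times, and every agent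
  approves the items on one hyperplane (165 items). One hyperplane is shared by 83 agents, so
  one of them gets value at most 1 and, by EQ1, nobody gets more than 2. As there are
  \<open>31 \<cdot> 11 = 341 > 3 \<cdot> 113\<close> items, some bundle has at least four items. Four points always lie on
  a common hyperplane, and the agent approving this hyperplane envies that bundle by more than
  one item.\<close>

definition approval_value :: "('b \<Rightarrow> 'a set) \<Rightarrow> 'b \<Rightarrow> 'a set \<Rightarrow> real" where
  "approval_value T i S = real (card (S \<inter> T i))"

lemma approval_value_singleton: "approval_value T i {x} = of_bool (x \<in> T i)"
  by (simp add: approval_value_def)

lemma additive_approval_value:
  assumes "finite M"
  shows "additive_valuation M (approval_value T i)"
  unfolding additive_valuation_def approval_value_singleton
proof (intro conjI allI impI)
  show "approval_value T i {} = 0" by (simp add: approval_value_def)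
next
  fix S assume "S \<subseteq> M"
  then have "finite S" using assms finite_subset by blast
  then show "approval_value T i S = (\<Sum>x\<in>S. of_bool (x \<in> T i))"
    by (simp add: approval_value_def of_bool_def sum.If_cases Int_def)
qed

text \<open>Serves EQ1 and EF1 alike: deleting one item costs at most one approved item. An infinite
  intersection is harmless, its \<open>card\<close> being 0.\<close>

lemma card_le_if_removal:
  assumes "approval_value T i (B - {g}) \<le> real c"
  shows "card (B \<inter> T i) \<le> Suc c"
proof (cases "finite (B \<inter> T i)")
  case True
  have "(B - {g}) \<inter> T i = (B \<inter> T i) - {g}" by blast
  then have "card (B \<inter> T i - {g}) \<le> c"
    using assms by (simp add: approval_value_def)
  then show ?thesis
    using card_Diff1_le[of "B \<inter> T i" g] card_Suc_Diff1[OF True, of g]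
    by (cases "g \<in> B \<inter> T i") auto
qed simp

text \<open>The bounds climb by one at each stage: \<open>q\<close> for some agent of
  \<open>G\<close>, \<open>q + 1\<close> for every agent by EQ1, \<open>q + 2\<close> for what any
  agent approves in another bundle by EF1. So \<open>q + 3\<close> items of one bundle must not all
  be approved by the same agent.\<close>

theorem no_EF1_EQ1_approval:
  assumes fin: "finite M"
    and G: "G \<subseteq> agents n" "\<And>i. i \<in> G \<Longrightarrow> T i \<subseteq> U" "finite U" "card U < Suc q * card G"
    and large: "(q + 2) * n < card M"
    and cover: "\<And>X. X \<subseteq> M \<Longrightarrow> card X = q + 3 \<Longrightarrow> \<exists>i\<in>agents n. X \<subseteq> T i"
    and A: "allocation n M A" "EF1 n (approval_value T) A" "EQ1 n (approval_value T) A"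
  shows False
proof -
  have sub: "A i \<subseteq> M" if "i \<in> agents n" for i
    using A(1) that by (auto simp: allocation_def)
  have finA: "finite (A i)" if "i \<in> agents n" for i
    using sub[OF that] fin finite_subset by blast
  have disj: "A i \<inter> A j = {}" if "i \<in> agents n" "j \<in> agents n" "i \<noteq> j" for i j
    using A(1) that by (auto simp: allocation_def)
  have un: "(\<Union>i\<in>agents n. A i) = M"
    using A(1) by (simp add: allocation_def)
  have fin_ag: "finite (agents n)" and card_ag: "card (agents n) = n"
    by (simp_all add: agents_def)
  have finG: "finite G" using G(1) fin_ag finite_subset by blast

  \<comment> \<open>Otherwise the disjoint sets \<open>A i \<inter> T i\<close> with
    \<open>i \<in> G\<close>, all inside \<open>U\<close>, would together have at least
    \<open>Suc q * card G\<close> elements.\<close>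
  obtain i0 where i0: "i0 \<in> G" "card (A i0 \<inter> T i0) \<le> q"
  proof (rule ccontr)
    assume "\<not> thesis"
    then have "\<And>i. i \<in> G \<Longrightarrow> Suc q \<le> card (A i \<inter> T i)"
      using that not_less_eq_eq by blast
    then have "card G * Suc q \<le> (\<Sum>i\<in>G. card (A i \<inter> T i))"
      using sum_bounded_below[of G "Suc q" "\<lambda>i. card (A i \<inter> T i)"] by simp
    also have "\<dots> = card (\<Union>i\<in>G. A i \<inter> T i)"
      using finG finA disj G(1) by (intro card_UN_disjoint[symmetric]) blast+
    also have "\<dots> \<le> card U"
      using G(2,3) by (intro card_mono) blast+
    finally show False using G(4) by (simp add: mult.commute)
  qed
  have i0': "i0 \<in> agents n" using i0 G(1) by blast

  have own: "card (A j \<inter> T j) \<le> Suc q" if j: "j \<in> agents n" for j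
  proof (cases "A j = {}")
    case False
    then obtain g where "approval_value T j (A j - {g}) \<le> approval_value T i0 (A i0)"
      using A(3) i0' j by (auto simp: EQ1_def)
    also have "\<dots> \<le> real q"
      using i0(2) by (simp add: approval_value_def)
    finally show ?thesis by (rule card_le_if_removal)
  qed simp

  obtain j where j: "j \<in> agents n" "q + 3 \<le> card (A j)"
  proof (rule ccontr)
    assume "\<not> thesis"
    then have "\<And>j. j \<in> agents n \<Longrightarrow> card (A j) \<le> q + 2"
      using that by fastforce
    then have "(\<Sum>j\<in>agents n. card (A j)) \<le> card (agents n) * (q + 2)"
      using sum_bounded_above[of "agents n" "\<lambda>j. card (A j)" "q + 2"] by simp
    moreover have "card M = (\<Sum>j\<in>agents n. card (A j))"
      unfolding un[symmetric] using fin_ag finA disj by (intro card_UN_disjoint) blast+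
    ultimately show False using large card_ag by (simp add: mult.commute)
  qed
  obtain X where X: "X \<subseteq> A j" "card X = q + 3"
    using obtain_subset_with_card_n[OF j(2)] by blast
  then obtain i where i: "i \<in> agents n" "X \<subseteq> T i"
    using cover[of X] sub[OF j(1)] by blast
  \<comment> \<open>The case \<open>i = j\<close> is not excluded; EF1 quantifies over this pair as
    well.\<close>
  have "A j \<noteq> {}" using j(2) by auto
  then obtain g where "approval_value T i (A j - {g}) \<le> approval_value T i (A i)"
    using A(2) i(1) j(1) by (auto simp: EF1_def)
  also have "\<dots> \<le> real (Suc q)"
    using own[OF i(1)] by (simp add: approval_value_def)
  finally have "card (A j \<inter> T i) \<le> Suc (Suc q)" by (rule card_le_if_removal)
  moreover have "card X \<le> card (A j \<inter> T i)"
    using X(1) i(2) finA[OF j(1)] by (intro card_mono) auto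
  ultimately show False using X(2) by simp
qed

text \<open>The standard bilinear form on \<open>\<bbbF>\<^sub>2\<^sup>d\<close>, vectors being given by the lowest \<open>d\<close> bits.\<close>

definition bit_form :: "nat \<Rightarrow> nat \<Rightarrow> nat \<Rightarrow> bool" where
  "bit_form d a x \<longleftrightarrow> odd (\<Sum>j<d. of_bool (bit a j \<and> bit x j) :: nat)"

lemma bit_form_commute: "bit_form d a x = bit_form d x a"
  by (simp add: bit_form_def conj_commute)

lemma bit_form_xor_left: "bit_form d (xor a b) x \<longleftrightarrow> bit_form d a x \<noteq> bit_form d b x"
  unfolding bit_form_def by (induction d) (auto simp: bit_xor_iff)

lemma bit_form_xor_right: "bit_form d a (xor x y) \<longleftrightarrow> bit_form d a x \<noteq> bit_form d a y"
  using bit_form_xor_left bit_form_commute by metis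

lemma bit_form_unit:
  assumes "j < d"
  shows "bit_form d a (2 ^ j) = bit a j"
proof -
  have "(\<Sum>k<d. of_bool (bit a k \<and> bit (2 ^ j :: nat) k) :: nat) = (\<Sum>k<d. if k = j then of_bool (bit a j) else 0)"
    by (intro sum.cong) (auto simp: bit_exp_iff)
  then show ?thesis using assms by (simp add: bit_form_def)
qed

text \<open>The low \<open>d\<close> bits of such an \<open>x\<close> are all 0, so it encodes the
  zero vector, which lies in every hyperplane.\<close>

lemma bit_form_dvd:
  assumes "2 ^ d dvd x"
  shows "\<not> bit_form d a x"
proof -
  have "\<not> bit x j" if "j < d" for j
    using assms that bit_take_bit_iff[of d x j] by (simp add: take_bit_eq_mod mod_eq_0_iff_dvd)
  then show ?thesis by (simp add: bit_form_def)
qed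

text \<open>Pigeonhole replaces a dimension count: the \<open>2 ^ d\<close> vectors \<open>a\<close>
  induce at most \<open>2 ^ card X\<close> patterns of form values on \<open>X\<close>, so two of
  them agree on \<open>X\<close>, and by linearity their \<open>xor\<close> vanishes there.\<close>

lemma ex_common_hyperplane:
  assumes "finite X" "card X < d"
  shows "\<exists>a\<in>{1..<2 ^ d}. \<forall>x\<in>X. \<not> bit_form d a x"
proof -
  let ?f = "\<lambda>a. {x \<in> X. bit_form d a x}"
  have "card (Pow X) < card {..<2 ^ d :: nat}"
    using assms by (simp add: card_Pow)
  moreover have "card (?f ` {..<2 ^ d}) \<le> card (Pow X)"
    using assms by (intro card_mono) auto
  ultimately have "\<not> inj_on ?f {..<2 ^ d}"
    by (intro pigeonhole) linarith
  then obtain a b where ab: "a < 2 ^ d" "b < 2 ^ d" "a \<noteq> b" "?f a = ?f b"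
    by (auto simp: inj_on_def)
  have "xor a b \<noteq> 0" using ab(3) by (metis xor.assoc xor.left_neutral xor_self_eq xor.right_neutral)
  moreover have "xor a b < 2 ^ d"
    using ab(1,2) by (simp flip: take_bit_nat_eq_self_iff)
  moreover have "\<forall>x\<in>X. \<not> bit_form d (xor a b) x"
    using ab(4) by (auto simp: bit_form_xor_left)
  ultimately show ?thesis
    by (intro bexI[of _ "xor a b"]) auto
qed

text \<open>Flipping a bit at which \<open>a\<close> is 1 toggles the form, hence swaps the zeros
  with the non-zeros. The factor \<open>c\<close> is the number of copies of the vector
  space.\<close>

lemma card_hyperplane:
  assumes "a \<in> {1..<2 ^ d}"
  shows "2 * card {x. x < c * 2 ^ d \<and> \<not> bit_form d a x} = c * 2 ^ d"
proof -
  obtain j where j: "bit a j"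
    using assms bit_eq_iff[of a 0] by auto
  have "take_bit d a = a" using assms by (simp add: take_bit_nat_eq_self_iff)
  with j have "j < d" by (metis bit_take_bit_iff)
  define h :: "nat \<Rightarrow> nat" where "h x = xor x (2 ^ j)" for x
  have hh: "h (h x) = x" for x by (simp add: h_def xor.assoc)
  have form_h: "bit_form d a (h x) \<longleftrightarrow> \<not> bit_form d a x" for x
    using j \<open>j < d\<close> by (simp add: h_def bit_form_xor_right bit_form_unit)
  \<comment> \<open>The flip stays within the low \<open>d\<close> bits, so it preserves the
    quotient by \<open>2 ^ d\<close>, on which alone the range condition depends.\<close>
  have "drop_bit d (h x) = drop_bit d x" for x
    using \<open>j < d\<close> by (intro bit_eqI) (auto simp: h_def bit_drop_bit_eq bit_xor_iff bit_exp_iff)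
  then have h_less: "h x < c * 2 ^ d \<longleftrightarrow> x < c * 2 ^ d" for x
    by (simp add: drop_bit_eq_div flip: div_less_iff_less_mult)
  let ?Z = "{x. x < c * 2 ^ d \<and> \<not> bit_form d a x}" and ?O = "{x. x < c * 2 ^ d \<and> bit_form d a x}"
  have "bij_betw h ?Z ?O"
    by (rule bij_betw_byWitness[where f' = h]) (auto simp: hh form_h h_less)
  then have "card ?Z = card ?O" by (rule bij_betw_same_card)
  moreover have "?Z \<union> ?O = {..<c * 2 ^ d}" by auto
  then have "card {..<c * 2 ^ d} = card ?Z + card ?O"
    by (subst card_Un_disjoint[symmetric]) auto
  ultimately show ?thesis by simp
qed

lemma card_multiples_less:
  assumes "0 < m"
  shows "card {x :: nat. x < c * m \<and> m dvd x} = c"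
proof -
  have "{x. x < c * m \<and> m dvd x} = (\<lambda>k. k * m) ` {..<c}"
    using assms by (auto elim!: dvdE simp: mult.commute)
  then show ?thesis using assms by (simp add: card_image inj_on_def)
qed

theorem corollary2:
  "\<exists>(M :: nat set) (v :: nat \<Rightarrow> nat set \<Rightarrow> real).
     is_instance 113 M v \<and> binary_goods 113 M v \<and> normalized 113 M v \<and>
     \<not> (\<exists>p. randomized_allocation 113 M p \<and> ex_post (EF1 113 v) p \<and> ex_post (EQ1 113 v) p)"
proof -
  \<comment> \<open>The low five bits of an item are its point, the quotient by 32 is the index of
    the copy (0 to 10). Multiples of 32 encode the zero vector and are left out.\<close>
  define M :: "nat set" where "M = {x. x < 11 * 2 ^ 5 \<and> \<not> 2 ^ 5 dvd x}"
  \<comment> \<open>The cap at 31 gives each nonzero vector to the agent of that number and lets the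
    agents 31 to 113 share the last hyperplane.\<close>
  define T where "T i = {x \<in> M. \<not> bit_form 5 (min i 31) x}" for i
  define v where "v = approval_value T"
  let ?D = "{x :: nat. x < 11 * 2 ^ 5 \<and> 2 ^ 5 dvd x}"
  have card_D: "card ?D = 11" by (rule card_multiples_less) simp
  have finM: "finite M" by (simp add: M_def)
  have "M = {..<11 * 2 ^ 5} - ?D" by (auto simp: M_def)
  then have card_M: "card M = 341"
    using card_D card_Diff_subset[of ?D "{..<11 * 2 ^ 5}"] by auto
  \<comment> \<open>Half of the 352 numbers, minus the 11 zero vectors: 176 - 11 = 165.\<close>
  have card_T: "card (T i) = 165" if "i \<in> agents 113" for i
  proof -
    let ?H = "{x. x < 11 * 2 ^ 5 \<and> \<not> bit_form 5 (min i 31) x}"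
    have "2 * card ?H = 11 * 2 ^ 5"
      using that by (intro card_hyperplane) (auto simp: agents_def)
    moreover have "T i = ?H - ?D" by (auto simp: T_def M_def)
    moreover have "?D \<subseteq> ?H" using bit_form_dvd by blast
    ultimately show ?thesis using card_D by (simp add: card_Diff_subset)
  qed
  have "is_instance 113 M v"
    using finM by (simp add: is_instance_def v_def additive_approval_value)
  moreover have "binary_goods 113 M v"
    by (simp add: binary_goods_def v_def approval_value_singleton)
  moreover have "normalized 113 M v"
  proof -
    have "M \<inter> T i = T i" for i by (auto simp: T_def)
    then show ?thesis by (simp add: normalized_def v_def approval_value_def card_T)
  qed
  moreover have False
    if p: "randomized_allocation 113 M p" "ex_post (EF1 113 v) p" "ex_post (EQ1 113 v) p" for p
  proof -
    \<comment> \<open>The support of a \<open>pmf\<close> is never empty, so refuting a single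
      deterministic allocation suffices.\<close>
    obtain A where "A \<in> set_pmf p" using set_pmf_not_empty[of p] by blast
    then have A: "allocation 113 M A" "EF1 113 v A" "EQ1 113 v A"
      using p by (auto simp: randomized_allocation_def ex_post_def)
    show False
    \<comment> \<open>Both counts are tight: 165 < 2 * 83 = 166 for the shared hyperplane, and 3 *
      113 = 339 < 341 for the items.\<close>
    proof (rule no_EF1_EQ1_approval[where q = 1 and G = "{31..113}" and U = "T 31"])
      show "\<exists>i\<in>agents 113. X \<subseteq> T i" if X: "X \<subseteq> M" "card X = 1 + 3" for X
      proof -
        have "finite X" using X(1) finM finite_subset by blast
        then obtain a where "a \<in> {1..<2 ^ 5}" "\<forall>x\<in>X. \<not> bit_form 5 a x"
          using ex_common_hyperplane[of X 5] X(2) by auto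
        \<comment> \<open>As \<open>a\<close> is at most 31, \<open>min a 31 = a\<close>, so the
          vector found is itself the number of an agent approving all of \<open>X\<close>.\<close>
        then show ?thesis
          using X(1) by (intro bexI[of _ a]) (auto simp: T_def agents_def)
      qed
      show "T i \<subseteq> T 31" if "i \<in> {31..113}" for i
        using that by (simp add: T_def)
    qed (use finM card_M card_T[of 31] A in \<open>auto simp: agents_def v_def intro: card_ge_0_finite\<close>)
  qed
  ultimately show ?thesis by blast
qed

end
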